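(* Let $\alpha_t\equiv\alpha$, $\beta_t\equiv\beta$ be constant with $0<\alpha<\beta$ and $\kappa=1-\alpha/\beta$. Being candid at all times ($\pi\equiv0$) is optimal for $\lambda$ sufficiently low: there is a threshold $\lambda_0>0$ depending on $\kappa$ (equivalently, on $\alpha/\beta$) such that the control $\pi\equiv0$ is optimal whenever $0<\lambda<\lambda_0$.
   Context: Fix $\sigma>0$. Let $\Phi$ be the standard normal distribution function, and for $t\in[0,1]$ put $h(t)=2\Phi(\sigma(1-t)/2)-1$ and $g(t)=\int_0^t h(u)\,\mathrm{d}u$. For $\lambda>0$, a control is a right-continuous function with left limits $\pi:[0,1]\to[0,1]$. The corresponding state (valuation) $\gamma_t$ solves $\gamma_t'=-\lambda\pi_t h(t)\gamma_t$, $\gamma_0=1$; write $\gamma^1_t=e^{-\lambda g(t)}$ for the state when $\pi\equiv1$. A control is optimal if it maximizes, over all controls, the objective $\int_0^1(1-\pi_t)\,\beta\,[\gamma^1_t-\kappa\gamma_t]\,\mathrm{d}t$. *)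

theory Defs
  imports "HOL-Probability.Probability"
begin

definition std_normal_cdf :: "real \<Rightarrow> real" where
  "std_normal_cdf = cdf (density lborel std_normal_density)"

definition h_fun :: "real \<Rightarrow> real \<Rightarrow> real" where
  "h_fun \<sigma> t = 2 * std_normal_cdf (\<sigma> * (1 - t) / 2) - 1"

definition g_fun :: "real \<Rightarrow> real \<Rightarrow> real" where
  "g_fun \<sigma> t = integral {0..t} (h_fun \<sigma>)"

definition control :: "(real \<Rightarrow> real) \<Rightarrow> bool" where
  "control \<pi> \<longleftrightarrow>
     (\<forall>t\<in>{0..1}. 0 \<le> \<pi> t \<and> \<pi> t \<le> 1) \<and>
     (\<forall>t\<in>{0..<1}. continuous (at_right t) \<pi>) \<and>
     (\<forall>t\<in>{0<..1}. \<exists>l. (\<pi> \<longlongrightarrow> l) (at_left t))"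

(* A control may have (at most countably many) jumps, at which the two-sided derivative of the
   state need not exist. The differential equation is therefore imposed off a countable set,
   together with continuity; this determines the state uniquely on {0..1}. *)
definition state :: "real \<Rightarrow> real \<Rightarrow> (real \<Rightarrow> real) \<Rightarrow> (real \<Rightarrow> real) \<Rightarrow> bool" where
  "state \<sigma> lam \<pi> \<gamma> \<longleftrightarrow>
     continuous_on {0..1} \<gamma> \<and> \<gamma> 0 = 1 \<and>
     (\<exists>S. countable S \<and>
        (\<forall>t\<in>{0..1} - S.
           (\<gamma> has_real_derivative (- lam * \<pi> t * h_fun \<sigma> t * \<gamma> t)) (at t within {0..1})))"

definition state1 :: "real \<Rightarrow> real \<Rightarrow> real \<Rightarrow> real" where
  "state1 \<sigma> lam t = exp (- lam * g_fun \<sigma> t)"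

definition objective ::
    "real \<Rightarrow> real \<Rightarrow> real \<Rightarrow> real \<Rightarrow> (real \<Rightarrow> real) \<Rightarrow> (real \<Rightarrow> real) \<Rightarrow> real" where
  "objective \<sigma> lam \<beta> \<kappa> \<pi> \<gamma> =
     integral {0..1} (\<lambda>t. (1 - \<pi> t) * \<beta> * (state1 \<sigma> lam t - \<kappa> * \<gamma> t))"

definition optimal :: "real \<Rightarrow> real \<Rightarrow> real \<Rightarrow> real \<Rightarrow> (real \<Rightarrow> real) \<Rightarrow> bool" where
  "optimal \<sigma> lam \<beta> \<kappa> \<pi> \<longleftrightarrow>
     control \<pi> \<and>
     (\<exists>\<gamma>. state \<sigma> lam \<pi> \<gamma> \<and>
        (\<forall>\<pi>' \<gamma>'. control \<pi>' \<and> state \<sigma> lam \<pi>' \<gamma>' \<longrightarrow>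
           objective \<sigma> lam \<beta> \<kappa> \<pi>' \<gamma>' \<le> objective \<sigma> lam \<beta> \<kappa> \<pi> \<gamma>))"

end

(* For a control pi with state gamma, write D = gamma^1 - kappa * gamma and
   F = (gamma^1 - kappa) + kappa * (1 - gamma 1) + kappa * gamma'.
   Since gamma decreases, the integrand satisfies (1 - pi) * D <= F as soon as lambda <= (1 - kappa) / 2,
   and F integrates over [0,1] to the value of the objective (divided by beta) at pi = 0.
   As gamma' exists only off a countable set, the two sides are compared through primitives, by a
   monotonicity criterion for right derivatives with a countable exceptional set. *)

theory Submission
  imports Defs
begin

section \<open>Monotonicity from right derivatives\<close>

(* Every level y strictly between f a and f b would be attained a last time, at a point where the
   right derivative cannot be negative; so all these levels would lie in the countable set f ` S. *)
lemma right_derivative_neg_imp_le: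
  fixes f :: "real \<Rightarrow> real"
  assumes "a \<le> b" and cont: "continuous_on {a..b} f" and "countable S"
    and deriv: "\<And>x. x \<in> {a..<b} - S \<Longrightarrow> \<exists>D<0. (f has_real_derivative D) (at x within {x..b})"
  shows "f b \<le> f a"
proof (rule ccontr)
  assume "\<not> f b \<le> f a"
  then have lt: "f a < f b" by simp
  have "{f a<..<f b} \<subseteq> f ` S"
  proof
    fix y assume y: "y \<in> {f a<..<f b}"
    let ?L = "{a..b} \<inter> f -` {..y}"
    have "closed ?L"
      by (rule continuous_closed_preimage[OF cont]) auto
    then have "compact ?L"
      by (metis bounded_Int bounded_closed_interval compact_eq_bounded_closed)
    moreover have "?L \<noteq> {}"
      using y \<open>a \<le> b\<close> by (auto intro!: exI[of _ a])
    ultimately obtain x where x: "x \<in> ?L" and last: "\<And>z. z \<in> ?L \<Longrightarrow> z \<le> x"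
      by (metis compact_attains_sup)
    have "x < b" using x y by (cases "x = b") auto
    have "continuous_on {x..b} f"
      by (rule continuous_on_subset[OF cont]) (use x in auto)
    \<comment> \<open>\<open>x\<close> is the last point of \<open>{a..b}\<close> with f at most y.
      The intermediate value theorem finds the value y somewhere from \<open>x\<close> on, and that
      can only be at \<open>x\<close> itself.\<close>
    then obtain z where "x \<le> z" "z \<le> b" "f z = y"
      using IVT'[of f x y b] x y by auto
    with last[of z] x have fx: "f x = y" by auto
    have "x \<in> S"
    proof (rule ccontr)
      assume "x \<notin> S"
      with deriv[of x] x \<open>x < b\<close> obtain D
        where "D < 0" "(f has_real_derivative D) (at x within {x..b})" by auto
      from has_real_derivative_neg_dec_right[OF this(2,1)] obtain d
        where d: "d > 0" "\<And>e. \<lbrakk>e > 0; x + e \<in> {x..b}; e < d\<rbrakk> \<Longrightarrow> f (x + e) < f x" by auto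
      \<comment> \<open>Small enough for the local decrease and for staying in the interval; then
        \<open>x + e\<close> also lies in \<open>?L\<close>, beyond its last point.\<close>
      define e where "e = min (d / 2) (b - x)"
      have "f (x + e) < f x"
        using d(1) \<open>x < b\<close> by (intro d(2)) (auto simp: e_def)
      moreover have "0 < e" "x + e \<le> b" using d(1) \<open>x < b\<close> by (auto simp: e_def)
      ultimately show False using last[of "x + e"] fx x by auto
    qed
    with fx show "y \<in> f ` S" by auto
  qed
  then have "countable {f a<..<f b}"
    using \<open>countable S\<close> countable_subset by blast
  with uncountable_open_interval lt show False by blast
qed

text \<open>Subtracting a line of arbitrarily small positive slope makes the right derivatives
  strictly negative, so the strict criterion applies.\<close>

lemma right_derivative_nonpos_imp_le:
  fixes f :: "real \<Rightarrow> real"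
  assumes "a \<le> b" and cont: "continuous_on {a..b} f" and "countable S"
    and deriv: "\<And>x. x \<in> {a..<b} - S \<Longrightarrow> \<exists>D\<le>0. (f has_real_derivative D) (at x within {x..b})"
  shows "f b \<le> f a"
proof (cases "a = b")
  case False
  with \<open>a \<le> b\<close> have "a < b" by simp
  show ?thesis
  proof (rule field_le_epsilon)
    fix e :: real assume "e > 0"
    \<comment> \<open>The slope for which the subtracted line rises by exactly \<open>e\<close> over
      \<open>{a..b}\<close>.\<close>
    define c where "c = e / (b - a)"
    have "c > 0" using \<open>e > 0\<close> \<open>a < b\<close> by (simp add: c_def)
    have "f b - c * b \<le> f a - c * a"
    proof (rule right_derivative_neg_imp_le[OF \<open>a \<le> b\<close> _ \<open>countable S\<close>])
      fix x assume "x \<in> {a..<b} - S"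
      with deriv obtain D where D: "D \<le> 0" "(f has_real_derivative D) (at x within {x..b})"
        by blast
      show "\<exists>D<0. ((\<lambda>x. f x - c * x) has_real_derivative D) (at x within {x..b})"
        by (rule exI[of _ "D - c"], use D \<open>c > 0\<close> in \<open>auto intro!: derivative_eq_intros\<close>)
    qed (intro continuous_intros cont)
    moreover have "c * (b - a) = e" using \<open>a < b\<close> by (simp add: c_def)
    ultimately show "f b \<le> f a + e" by (simp add: algebra_simps)
  qed
qed simp

text \<open>At a jump a control is only right-continuous, hence this one-sided fundamental theorem.
  Taking \<open>x\<close> as base point makes the filter right-sided; the constant integral over
  \<open>{a..x}\<close> is added back.\<close>

lemma integral_has_right_derivative:
  fixes f :: "real \<Rightarrow> real"
  assumes int: "f integrable_on {a..b}" and x: "x \<in> {a..<b}" and cont: "continuous (at_right x) f"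
  shows "((\<lambda>u. integral {a..u} f) has_real_derivative f x) (at x within {x..b})"
proof -
  have "at_right x = at x within {x..b}"
    using x at_within_Icc_at_right[of x b] by simp
  \<comment> \<open>The \<open>- {}\<close> matches the library rule, which allows for an
    exceptional set; here it is empty.\<close>
  with cont have "continuous (at x within ({x..b} - {})) f" by simp
  moreover have "f integrable_on {x..b}"
    by (rule integrable_on_subinterval[OF int]) (use x in auto)
  ultimately have "((\<lambda>u. integral {x..u} f) has_vector_derivative f x) (at x within ({x..b} - {}))"
    by (intro integral_has_vector_derivative_continuous_at) (use x in auto)
  then have "((\<lambda>u. integral {a..x} f + integral {x..u} f) has_real_derivative f x)
      (at x within {x..b})"
    by (auto simp: has_real_derivative_iff_has_vector_derivative intro!: derivative_eq_intros)
  then show ?thesis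
  proof (rule has_field_derivative_transform_within[where d = 1])
    fix u assume "u \<in> {x..b}"
    then show "integral {a..x} f + integral {x..u} f = integral {a..u} f"
      using x by (intro Henstock_Kurzweil_Integration.integral_combine
          integrable_on_subinterval[OF int]) auto
  qed (use x in auto)
qed

section \<open>The standard normal distribution function\<close>

lemma std_normal_cdf_mono: "x \<le> y \<Longrightarrow> std_normal_cdf x \<le> std_normal_cdf y"
proof -
  interpret real_distribution "density lborel std_normal_density" by (rule real_dist_normal_dist)
  show "x \<le> y \<Longrightarrow> ?thesis" unfolding std_normal_cdf_def by (rule cdf_nondecreasing)
qed

lemma std_normal_cdf_le_1: "std_normal_cdf x \<le> 1"
proof -
  interpret real_distribution "density lborel std_normal_density" by (rule real_dist_normal_dist)
  show ?thesis unfolding std_normal_cdf_def by (rule cdf_bounded_prob)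
qed

text \<open>The density is even, so reflection gives both closed half-lines the same mass; they
  cover the line, and subadditivity yields the bound.\<close>

lemma std_normal_cdf_0_ge_half: "std_normal_cdf 0 \<ge> 1 / 2"
proof -
  let ?N = "density lborel std_normal_density"
  interpret real_distribution ?N by (rule real_dist_normal_dist)
  have "emeasure ?N {..0} = (\<integral>\<^sup>+x. ennreal (std_normal_density x) * indicator {..0} x \<partial>lborel)"
    by (subst emeasure_density) auto
  also have "\<dots> = (\<integral>\<^sup>+x. ennreal (std_normal_density (- x)) * indicator {..0} (- x) \<partial>lborel)"
    by (subst nn_integral_real_affine[where c = "-1" and t = 0]) auto
  also have "\<dots> = (\<integral>\<^sup>+x. ennreal (std_normal_density x) * indicator {0..} x \<partial>lborel)"
    by (intro nn_integral_cong) (auto simp: std_normal_density_def split: split_indicator)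
  also have "\<dots> = emeasure ?N {0..}"
    by (subst emeasure_density) auto
  finally have "prob {..0} = prob {0..}" by (simp add: measure_def)
  moreover have "prob {..0} + prob {0..} \<ge> prob ({..0} \<union> {0..})"
    by (rule measure_Un_le) auto
  moreover have "{..0} \<union> {0..} = (UNIV :: real set)" by auto
  ultimately show ?thesis
    using prob_space by (simp add: std_normal_cdf_def cdf_def)
qed

section \<open>Bounds on h, g and the states\<close>

context
  fixes \<sigma> :: real
  assumes sigma: "\<sigma> > 0"
begin

lemma h_fun_bounds:
  assumes "t \<le> 1"
  shows "0 \<le> h_fun \<sigma> t" "h_fun \<sigma> t \<le> 1"
proof -
  have "0 \<le> \<sigma> * (1 - t) / 2" using sigma assms by simp
  from std_normal_cdf_mono[OF this] std_normal_cdf_0_ge_half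
  show "0 \<le> h_fun \<sigma> t" by (simp add: h_fun_def)
  show "h_fun \<sigma> t \<le> 1"
    using std_normal_cdf_le_1[of "\<sigma> * (1 - t) / 2"] by (simp add: h_fun_def)
qed

lemma h_fun_integrable: "h_fun \<sigma> integrable_on {a..b}"
proof -
  \<comment> \<open>\<open>h_fun\<close> is decreasing in t, so its negative falls under the
    integrability of monotone functions.\<close>
  have "(\<lambda>t. - h_fun \<sigma> t) integrable_on {a..b}"
    using sigma
    by (intro integrable_on_mono_on)
      (auto simp: mono_on_def h_fun_def intro!: std_normal_cdf_mono divide_right_mono mult_left_mono)
  then show ?thesis by (simp add: integrable_neg_iff)
qed

lemma g_fun_le:
  assumes "t \<in> {0..1}"
  shows "g_fun \<sigma> t \<le> t"
proof -
  have "integral {0..t} (h_fun \<sigma>) \<le> integral {0..t} (\<lambda>_. 1)"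
    using assms h_fun_bounds by (intro integral_le h_fun_integrable) auto
  with assms show ?thesis by (simp add: g_fun_def)
qed

lemma continuous_on_state1: "continuous_on {0..1} (state1 \<sigma> lam)"
  unfolding state1_def g_fun_def
  by (intro continuous_intros indefinite_integral_continuous_1 h_fun_integrable)

text \<open>Combines exp(-x) >= 1 - x with g <= 1. This uniform linear bound is what makes the
  threshold explicit.\<close>

lemma state1_ge:
  assumes "t \<in> {0..1}" "lam \<ge> 0"
  shows "state1 \<sigma> lam t \<ge> 1 - lam"
proof -
  have "lam * g_fun \<sigma> t \<le> lam * 1"
    using g_fun_le[OF assms(1)] assms by (intro mult_left_mono) auto
  moreover have "1 + - lam * g_fun \<sigma> t \<le> exp (- lam * g_fun \<sigma> t)"
    by (rule exp_ge_add_one_self)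
  ultimately show ?thesis by (simp add: state1_def)
qed

(* Since positivity of the state is not yet known, monotonicity is first shown for its square. *)
lemma state_nonneg_antimono:
  assumes st: "state \<sigma> lam \<pi> \<gamma>" and pi: "\<And>t. t \<in> {0..1} \<Longrightarrow> 0 \<le> \<pi> t" and lam: "lam \<ge> 0"
  shows "t \<in> {0..1} \<Longrightarrow> 0 \<le> \<gamma> t"
    and "0 \<le> s \<Longrightarrow> s \<le> t \<Longrightarrow> t \<le> 1 \<Longrightarrow> \<gamma> t \<le> \<gamma> s"
proof -
  from st obtain S where cont: "continuous_on {0..1} \<gamma>" and "\<gamma> 0 = 1" and "countable S"
    and der: "\<And>t. t \<in> {0..1} - S \<Longrightarrow>
      (\<gamma> has_real_derivative (- lam * \<pi> t * h_fun \<sigma> t * \<gamma> t)) (at t within {0..1})"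
    unfolding state_def by blast
  have sq: "(\<gamma> t)\<^sup>2 \<le> (\<gamma> s)\<^sup>2" if st: "0 \<le> s" "s \<le> t" "t \<le> 1" for s t
  proof (rule right_derivative_nonpos_imp_le[OF \<open>s \<le> t\<close> _ \<open>countable S\<close>])
    show "continuous_on {s..t} (\<lambda>x. (\<gamma> x)\<^sup>2)"
      using st by (intro continuous_intros continuous_on_subset[OF cont]) auto
    fix x assume x: "x \<in> {s..<t} - S"
    then have "(\<gamma> has_real_derivative (- lam * \<pi> x * h_fun \<sigma> x * \<gamma> x)) (at x within {x..t})"
      using st by (intro DERIV_subset[OF der]) auto
    \<comment> \<open>The derivative of the square contains \<gamma> only squared, so its sign does
      not depend on that of \<gamma>.\<close>
    then have "((\<lambda>x. (\<gamma> x)\<^sup>2) has_real_derivative - (2 * (lam * \<pi> x * h_fun \<sigma> x * (\<gamma> x)\<^sup>2)))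
        (at x within {x..t})"
      by (auto intro!: derivative_eq_intros simp: power2_eq_square)
    moreover have "0 \<le> lam * \<pi> x * h_fun \<sigma> x * (\<gamma> x)\<^sup>2"
      using lam pi[of x] h_fun_bounds[of x] x st by (intro mult_nonneg_nonneg) auto
    ultimately show "\<exists>D\<le>0. ((\<lambda>x. (\<gamma> x)\<^sup>2) has_real_derivative D) (at x within {x..t})"
      by (intro exI conjI) auto
  qed
  show nonneg: "0 \<le> \<gamma> t" if t: "t \<in> {0..1}" for t
  proof (rule ccontr)
    assume neg: "\<not> 0 \<le> \<gamma> t"
    have "continuous_on {0..t} \<gamma>"
      by (rule continuous_on_subset[OF cont]) (use t in auto)
    \<comment> \<open>A negative value forces an earlier zero, after which the decreasing square
      must stay 0.\<close>
    then obtain s where s: "0 \<le> s" "s \<le> t" "\<gamma> s = 0"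
      using IVT2'[of \<gamma> t 0 0] neg t \<open>\<gamma> 0 = 1\<close> by auto
    with sq[of s t] neg t show False by auto
  qed
  show "\<gamma> t \<le> \<gamma> s" if "0 \<le> s" "s \<le> t" "t \<le> 1"
    using sq[OF that] nonneg[of s] that by (auto intro: power2_le_imp_le)
qed

section \<open>Comparison with the candid control\<close>

lemma candid_dominates:
  assumes ctrl: "control \<pi>" and st: "state \<sigma> lam \<pi> \<gamma>"
    and \<kappa>: "0 < \<kappa>" and lam: "0 < lam" "lam \<le> (1 - \<kappa>) / 2"
  shows "integral {0..1} (\<lambda>t. (1 - \<pi> t) * (state1 \<sigma> lam t - \<kappa> * \<gamma> t))
    \<le> integral {0..1} (\<lambda>t. state1 \<sigma> lam t - \<kappa>)"
proof -
  let ?q = "\<lambda>t. (1 - \<pi> t) * (state1 \<sigma> lam t - \<kappa> * \<gamma> t)"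
  let ?r = "\<lambda>t. state1 \<sigma> lam t - \<kappa>"
  have r_int: "?r integrable_on {0..1}"
    by (intro integrable_continuous_real continuous_intros continuous_on_state1)
  from ctrl have pi: "0 \<le> \<pi> t" "\<pi> t \<le> 1" if "t \<in> {0..1}" for t
    using that by (auto simp: control_def)
  from st obtain S where cont: "continuous_on {0..1} \<gamma>" and g0: "\<gamma> 0 = 1" and "countable S"
    and der: "\<And>t. t \<in> {0..1} - S \<Longrightarrow>
      (\<gamma> has_real_derivative (- lam * \<pi> t * h_fun \<sigma> t * \<gamma> t)) (at t within {0..1})"
    unfolding state_def by blast
  have nonneg: "0 \<le> \<gamma> t" and anti: "\<gamma> 1 \<le> \<gamma> t" and le1: "\<gamma> t \<le> 1" if "t \<in> {0..1}" for t
    using state_nonneg_antimono(1)[OF st pi(1), of t] state_nonneg_antimono(2)[OF st pi(1), of t 1]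
      state_nonneg_antimono(2)[OF st pi(1), of 0 t] that lam g0 by auto
  show ?thesis
  proof (cases "?q integrable_on {0..1}")
    case False
    \<comment> \<open>A non-integrable integrand has integral 0 by convention, so nonnegativity of
      the right-hand side suffices.\<close>
    have "0 \<le> integral {0..1} ?r"
    proof (rule integral_nonneg[OF r_int])
      fix t :: real assume "t \<in> {0..1}"
      with state1_ge[of t lam] \<kappa> lam show "0 \<le> ?r t" by simp
    qed
    with False show ?thesis by (simp add: not_integrable_integral)
  next
    case True
    let ?k = "\<lambda>t. ?q t - ?r t"
    \<comment> \<open>A primitive of (1 - \<pi>) D - F. Its last two terms have increments that
      cancel over [0,1], so \<open>?G 1 - ?G 0\<close> is the integral of \<open>?k\<close>.\<close>
    let ?G = "\<lambda>t. integral {0..t} ?k - \<kappa> * (1 - \<gamma> 1) * t - \<kappa> * \<gamma> t"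
    have k_int: "?k integrable_on {0..1}"
      by (intro integrable_diff True r_int)
    have "?G 1 \<le> ?G 0"
    proof (rule right_derivative_nonpos_imp_le[where f = ?G, OF _ _ \<open>countable S\<close>])
      show "continuous_on {0..1} ?G"
        by (intro continuous_intros cont indefinite_integral_continuous_1 k_int)
      fix x :: real assume x: "x \<in> {0..<1} - S"
      have "at_right x = at x within {x..1}"
        using x at_within_Icc_at_right[of x 1] by simp
      moreover have "continuous (at x within {x..1}) f" if "continuous_on {0..1} f"
        for f :: "real \<Rightarrow> real"
        using continuous_on_subset[OF that, of "{x..1}"] x
        by (auto simp: continuous_on_eq_continuous_within)
      moreover have "continuous (at_right x) \<pi>"
        using ctrl x by (auto simp: control_def)
      ultimately have "continuous (at_right x) ?k"
        using cont continuous_on_state1 by (auto intro!: continuous_intros)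
      then have "((\<lambda>u. integral {0..u} ?k) has_real_derivative ?k x) (at x within {x..1})"
        using x by (intro integral_has_right_derivative k_int) auto
      moreover have "(\<gamma> has_real_derivative (- lam * \<pi> x * h_fun \<sigma> x * \<gamma> x)) (at x within {x..1})"
        using x by (intro DERIV_subset[OF der]) auto
      ultimately have "(?G has_real_derivative
          ?k x - \<kappa> * (1 - \<gamma> 1) - \<kappa> * (- lam * \<pi> x * h_fun \<sigma> x * \<gamma> x)) (at x within {x..1})"
        by (auto intro!: derivative_eq_intros)
      \<comment> \<open>The negated left-hand side equals \<pi> (D - \<kappa> \<gamma> lam h) +
        \<kappa> (\<gamma> x - \<gamma> 1), and both summands are shown to be nonnegative.\<close>
      moreover have "?k x - \<kappa> * (1 - \<gamma> 1) - \<kappa> * (- lam * \<pi> x * h_fun \<sigma> x * \<gamma> x) \<le> 0"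
      proof -
        have x01: "x \<in> {0..1}" using x by auto
        have le_\<kappa>: "\<kappa> * \<gamma> x \<le> \<kappa>"
          using mult_left_mono[OF le1[OF x01], of \<kappa>] \<kappa> by simp
        also have "\<kappa> \<le> 1" using lam by simp
        finally have "(\<kappa> * \<gamma> x) * (lam * h_fun \<sigma> x) \<le> 1 * (lam * 1)"
          using lam h_fun_bounds[of x] x01 by (intro mult_mono) auto
        \<comment> \<open>The threshold enters here, as (1 - lam) - \<kappa> - lam >= 0. The
          variable \<open>p\<close> hides a nonlinear product, leaving linear arithmetic.\<close>
        moreover have "0 \<le> state1 \<sigma> lam x - \<kappa> * \<gamma> x - p" if "p \<le> 1 * (lam * 1)" for p
          using state1_ge[OF x01 less_imp_le[OF lam(1)]] le_\<kappa> lam that by simp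
        ultimately have "0 \<le> state1 \<sigma> lam x - \<kappa> * \<gamma> x - (\<kappa> * \<gamma> x) * (lam * h_fun \<sigma> x)"
          by blast
        then have "0 \<le> \<pi> x * (state1 \<sigma> lam x - \<kappa> * \<gamma> x - (\<kappa> * \<gamma> x) * (lam * h_fun \<sigma> x))"
          using pi[OF x01] by (intro mult_nonneg_nonneg) auto
        moreover have "0 \<le> \<kappa> * (\<gamma> x - \<gamma> 1)"
          using \<kappa> anti[OF x01] by simp
        ultimately show ?thesis by (simp add: algebra_simps)
      qed
      ultimately show "\<exists>D\<le>0. (?G has_real_derivative D) (at x within {x..1})"
        by blast
    qed simp
    then have "integral {0..1} ?k \<le> 0"
      using g0 by (simp add: algebra_simps)
    then show ?thesis
      using integral_diff[OF True r_int] by simp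
  qed
qed

end

section \<open>Choice of the threshold\<close>

theorem corollary2:
  fixes \<sigma> \<kappa> :: real
  assumes "\<sigma> > 0"
  shows "\<exists>lam0>0. \<forall>\<alpha> \<beta> lam.
           0 < \<alpha> \<and> \<alpha> < \<beta> \<and> \<kappa> = 1 - \<alpha> / \<beta> \<and> 0 < lam \<and> lam < lam0 \<longrightarrow>
             optimal \<sigma> lam \<beta> \<kappa> (\<lambda>t. 0)"
proof (cases "\<kappa> < 1")
  case False
  \<comment> \<open>For \<kappa> >= 1 no admissible \<alpha>, \<beta> exist, so any positive
    threshold serves.\<close>
  have "\<not> \<kappa> = 1 - \<alpha> / \<beta>" if "0 < \<alpha>" "\<alpha> < \<beta>" for \<alpha> \<beta>
  proof -
    have "0 < \<alpha> / \<beta>" using that by simp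
    with False show ?thesis by linarith
  qed
  then show ?thesis by (intro exI[of _ 1]) auto
next
  case True
  show ?thesis
  \<comment> \<open>This threshold equals \<alpha> / (2 \<beta>) and is uniform in \<sigma>.\<close>
  proof (intro exI[of _ "(1 - \<kappa>) / 2"] conjI allI impI)
    show "0 < (1 - \<kappa>) / 2" using True by simp
    fix \<alpha> \<beta> lam :: real
    assume *: "0 < \<alpha> \<and> \<alpha> < \<beta> \<and> \<kappa> = 1 - \<alpha> / \<beta> \<and> 0 < lam \<and> lam < (1 - \<kappa>) / 2"
    then have "\<beta> > 0" "\<kappa> > 0" "0 < lam" "lam \<le> (1 - \<kappa>) / 2" by auto
    have objective_eq: "objective \<sigma> lam \<beta> \<kappa> \<pi> \<gamma> =
        \<beta> * integral {0..1} (\<lambda>t. (1 - \<pi> t) * (state1 \<sigma> lam t - \<kappa> * \<gamma> t))" for \<pi> \<gamma>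
      unfolding objective_def integral_mult_right[symmetric] by (simp add: mult_ac)
    have "control (\<lambda>t. 0)" by (auto simp: control_def)
    moreover have "state \<sigma> lam (\<lambda>t. 0) (\<lambda>t. 1)"
      by (auto simp: state_def intro!: exI[of _ "{}"])
    moreover have "objective \<sigma> lam \<beta> \<kappa> \<pi> \<gamma> \<le> objective \<sigma> lam \<beta> \<kappa> (\<lambda>t. 0) (\<lambda>t. 1)"
      if "control \<pi>" "state \<sigma> lam \<pi> \<gamma>" for \<pi> \<gamma>
      using candid_dominates[OF assms that \<open>\<kappa> > 0\<close> \<open>0 < lam\<close> \<open>lam \<le> _\<close>] \<open>\<beta> > 0\<close>
      by (simp add: objective_eq)
    ultimately show "optimal \<sigma> lam \<beta> \<kappa> (\<lambda>t. 0)"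
      unfolding optimal_def by blast
  qed
qed

end
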